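(* Let $\rho: SB_3\to\mathrm{GL}_3(\mathbb{C})$ be a representation of the form $$\rho(\sigma_1)=\begin{pmatrix} \lambda_1 & \lambda_1\lambda_2^{-1}\lambda_3+\lambda_2 & \lambda_2 \\ 0 & \lambda_2 & \lambda_2 \\ 0 & 0 & \lambda_3 \end{pmatrix},\qquad \rho(\sigma_2)=\begin{pmatrix} \lambda_3 & 0 & 0 \\ -\lambda_2 & \lambda_2 & 0 \\ \lambda_2 & -\lambda_1\lambda_2^{-1}\lambda_3-\lambda_2 & \lambda_1 \end{pmatrix},$$ $$\rho(\tau_1)=\begin{pmatrix} a_1 & b_1 & c_1 \\ 0 & e_1 & f_1 \\ 0 & 0 & i_1 \end{pmatrix},\qquad \rho(\tau_2)=\begin{pmatrix} a_2 & 0 & 0 \\ d_2 & e_2 & 0 \\ g_2 & h_2 & i_2 \end{pmatrix},$$ where all entries are complex numbers, $\lambda_1,\lambda_2,\lambda_3,a_1,e_1,i_1,a_2,e_2,i_2$ are nonzero, $(\lambda_1^2+\lambda_2\lambda_3)(\lambda_2^2+\lambda_1\lambda_3)(\lambda_3^2+\lambda_1\lambda_2)\neq 0$, $\lambda_2\neq-\lambda_3$, and $$a_1=i_2=\frac{c_1\lambda_2(\lambda_1-\lambda_2)(\lambda_1-\lambda_3)+e_1\lambda_1\lambda_2(\lambda_2+\lambda_3)+f_1\lambda_3(\lambda_1-\lambda_2)(\lambda_1+\lambda_2)}{\lambda_1\lambda_2(\lambda_2+\lambda_3)},$$ $$b_1=-h_2=\frac{(\lambda_1\lambda_3+\lambda_2^2)\bigl(c_1\lambda_2(\lambda_1-\lambda_3)+f_1\lambda_3(\lambda_1+\lambda_2)\bigr)}{\lambda_1\lambda_2^2(\lambda_2+\lambda_3)},$$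 $$i_1=a_2=e_1+f_1\Bigl(\frac{\lambda_3}{\lambda_2}-1\Bigr),\qquad d_2=-f_1,\qquad e_2=e_1,\qquad g_2=c_1.$$ Then $\rho$ is irreducible.
   Context: The singular braid group $SB_3$ is the group generated by $\sigma_1,\sigma_2,\tau_1,\tau_2$ with defining relations $\sigma_1\sigma_2\sigma_1=\sigma_2\sigma_1\sigma_2$, $\tau_1\sigma_1=\sigma_1\tau_1$, $\tau_2\sigma_2=\sigma_2\tau_2$, $\sigma_1\sigma_2\tau_1=\tau_2\sigma_1\sigma_2$, $\sigma_2\sigma_1\tau_2=\tau_1\sigma_2\sigma_1$. A representation $G\to\mathrm{GL}_m(\mathbb{C})$ is irreducible if no subspace of $\mathbb{C}^m$ other than $0$ and $\mathbb{C}^m$ is invariant under the image of $G$. *)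

theory Defs
  imports "HOL-Analysis.Analysis" "HOL-Algebra.Group"
begin

section \<open>Groups given by generators and relations\<close>

text \<open>A letter \<open>(x, True)\<close> stands for the generator \<open>x\<close>, and \<open>(x, False)\<close> for its formal inverse.
  The type \<open>'a\<close> is the set of generators; a relation \<open>u = v\<close> is the pair \<open>(u, v)\<close>.\<close>

type_synonym 'a gword = "('a \<times> bool) list"

inductive pres_eq :: "('a gword \<times> 'a gword) set \<Rightarrow> 'a gword \<Rightarrow> 'a gword \<Rightarrow> bool"
  for R :: "('a gword \<times> 'a gword) set" where
  refl: "pres_eq R u u"
| sym: "pres_eq R u v \<Longrightarrow> pres_eq R v u"
| trans: "pres_eq R u v \<Longrightarrow> pres_eq R v w \<Longrightarrow> pres_eq R u w"
| cancel: "pres_eq R (u @ [(x, b), (x, \<not> b)] @ v) (u @ v)"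
| relator: "(r, s) \<in> R \<Longrightarrow> pres_eq R (u @ r @ v) (u @ s @ v)"

definition pres_rel :: "('a gword \<times> 'a gword) set \<Rightarrow> ('a gword \<times> 'a gword) set" where
  "pres_rel R = {(u, v). pres_eq R u v}"

definition pres_class :: "('a gword \<times> 'a gword) set \<Rightarrow> 'a gword \<Rightarrow> 'a gword set" where
  "pres_class R u = pres_rel R `` {u}"

definition presented_group :: "('a gword \<times> 'a gword) set \<Rightarrow> 'a gword set monoid" where
  "presented_group R =
     \<lparr>carrier = UNIV // pres_rel R,
      mult = (\<lambda>A B. \<Union>u\<in>A. \<Union>v\<in>B. pres_class R (u @ v)),
      one = pres_class R []\<rparr>"

definition pres_gen :: "('a gword \<times> 'a gword) set \<Rightarrow> 'a \<Rightarrow> 'a gword set" where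
  "pres_gen R x = pres_class R [(x, True)]"

lemma equiv_pres_rel: "equiv UNIV (pres_rel R)"
  by (rule equivI)
     (auto simp: pres_rel_def refl_on_def sym_def trans_def intro: pres_eq.intros)

lemma pres_class_eq_iff: "pres_class R u = pres_class R v \<longleftrightarrow> pres_eq R u v"
  using eq_equiv_class_iff[OF equiv_pres_rel, of u v R]
  by (simp add: pres_class_def pres_rel_def)

lemma pres_eq_ctxt: "pres_eq R u v \<Longrightarrow> pres_eq R (p @ u @ q) (p @ v @ q)"
proof (induction rule: pres_eq.induct)
  case (cancel u x b v)
  then show ?case using pres_eq.cancel[of R "p @ u" x b "v @ q"] by simp
next
  case (relator r s u v)
  then show ?case using pres_eq.relator[of r s R "p @ u" "v @ q"] by simp
qed (blast intro: pres_eq.refl pres_eq.sym pres_eq.trans)+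

lemma pres_eq_append: "pres_eq R u u' \<Longrightarrow> pres_eq R v v' \<Longrightarrow> pres_eq R (u @ v) (u' @ v')"
  using pres_eq_ctxt[of R u u' "[]" v] pres_eq_ctxt[of R v v' u' "[]"]
  by (auto intro: pres_eq.trans)

lemma presented_group_mult [simp]:
  "pres_class R u \<otimes>\<^bsub>presented_group R\<^esub> pres_class R v = pres_class R (u @ v)"
proof -
  have "congruent2 (pres_rel R) (pres_rel R) (\<lambda>u v. pres_class R (u @ v))"
    by (auto simp: congruent2_def pres_rel_def pres_class_eq_iff intro: pres_eq_append)
  from UN_equiv_class2[OF equiv_pres_rel equiv_pres_rel this, of u v]
  show ?thesis by (simp add: presented_group_def pres_class_def)
qed

lemma presented_group_one: "\<one>\<^bsub>presented_group R\<^esub> = pres_class R []"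
  by (simp add: presented_group_def)

lemma presented_group_carrier: "carrier (presented_group R) = range (pres_class R)"
  by (auto simp: presented_group_def quotient_def pres_class_def)

lemma pres_gen_carrier: "pres_gen R x \<in> carrier (presented_group R)"
  by (simp add: presented_group_carrier pres_gen_def)

lemma pres_class_left_inverse:
  "\<exists>v. pres_class R (v @ u) = pres_class R []"
proof (induction u)
  case Nil
  show ?case by (intro exI[of _ "[]"]) simp
next
  case (Cons l u)
  obtain x b where l: "l = (x, b)" by (cases l)
  from Cons obtain v where v: "pres_eq R (v @ u) []" by (auto simp: pres_class_eq_iff)
  have "pres_eq R ((v @ [(x, \<not> b)]) @ l # u) (v @ u)"
    using pres_eq.cancel[of R v x "\<not> b" u] by (simp add: l)
  with v show ?case unfolding pres_class_eq_iff by (blast intro: pres_eq.trans)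
qed

lemma group_presented_group: "group (presented_group R)"
proof (rule groupI)
  fix A assume "A \<in> carrier (presented_group R)"
  then obtain u where "A = pres_class R u" by (auto simp: presented_group_carrier)
  moreover obtain v where "pres_class R (v @ u) = pres_class R []"
    using pres_class_left_inverse by blast
  ultimately show "\<exists>B\<in>carrier (presented_group R). B \<otimes>\<^bsub>presented_group R\<^esub> A = \<one>\<^bsub>presented_group R\<^esub>"
    by (auto simp: presented_group_carrier presented_group_one)
qed (auto simp: presented_group_carrier presented_group_one)


section \<open>The singular braid group on three strands\<close>

datatype sb3_gen = Sigma1 | Sigma2 | Tau1 | Tau2

text \<open>A word without inverse letters.\<close>

definition pos_word :: "'a list \<Rightarrow> 'a gword" where
  "pos_word xs = map (\<lambda>x. (x, True)) xs"

definition SB3_relations :: "(sb3_gen gword \<times> sb3_gen gword) set" where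
  "SB3_relations =
     {(pos_word [Sigma1, Sigma2, Sigma1], pos_word [Sigma2, Sigma1, Sigma2]),
      (pos_word [Tau1, Sigma1], pos_word [Sigma1, Tau1]),
      (pos_word [Tau2, Sigma2], pos_word [Sigma2, Tau2]),
      (pos_word [Sigma1, Sigma2, Tau1], pos_word [Tau2, Sigma1, Sigma2]),
      (pos_word [Sigma2, Sigma1, Tau2], pos_word [Tau1, Sigma2, Sigma1])}"

definition SB3 :: "sb3_gen gword set monoid" where
  "SB3 = presented_group SB3_relations"

definition SB3_gen :: "sb3_gen \<Rightarrow> sb3_gen gword set" where
  "SB3_gen = pres_gen SB3_relations"


section \<open>Complex matrix representations\<close>

definition GL :: "(complex ^ 'n ^ 'n) monoid" where
  "GL = \<lparr>carrier = {A. invertible A}, mult = (**), one = mat 1\<rparr>"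

lemma group_GL: "group (GL :: (complex ^ 'n ^ 'n) monoid)"
proof (rule groupI)
  fix A :: "complex ^ 'n ^ 'n"
  assume "A \<in> carrier GL"
  then obtain B where "A ** B = mat 1" "B ** A = mat 1" by (auto simp: GL_def invertible_def)
  then show "\<exists>B\<in>carrier GL. B \<otimes>\<^bsub>GL\<^esub> A = \<one>\<^bsub>GL\<^esub>"
    by (intro bexI[of _ B]) (auto simp: GL_def invertible_def)
qed (auto simp: GL_def matrix_mul_assoc invertible_mult invertible_def[of "mat 1"])

text \<open>\<open>vec.subspace\<close> is the notion of subspace over the complex scalars;
  the unqualified \<open>subspace\<close> would be over the reals.\<close>

definition irreducible_rep :: "('g, 'x) monoid_scheme \<Rightarrow> ('g \<Rightarrow> complex ^ 'n ^ 'n) \<Rightarrow> bool" where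
  "irreducible_rep G \<rho> \<longleftrightarrow>
     (\<forall>V :: (complex ^ 'n) set.
        vec.subspace V \<and> (\<forall>g\<in>carrier G. \<forall>v\<in>V. \<rho> g *v v \<in> V) \<longrightarrow> V = {0} \<or> V = UNIV)"

definition mat3 :: "'a::zero \<Rightarrow> 'a \<Rightarrow> 'a \<Rightarrow> 'a \<Rightarrow> 'a \<Rightarrow> 'a \<Rightarrow> 'a \<Rightarrow> 'a \<Rightarrow> 'a \<Rightarrow> 'a ^ 3 ^ 3" where
  "mat3 a b c d e f g h i = vector [vector [a, b, c], vector [d, e, f], vector [g, h, i]]"

end

theory Submission
  imports Defs
begin

text \<open>The two braid generators alone act irreducibly. Write \<open>A\<close> and \<open>B\<close> for their images and
  \<open>e\<^sub>1, e\<^sub>2, e\<^sub>3\<close> for the standard basis. The matrices \<open>(A - \<lambda>\<^sub>2)(A - \<lambda>\<^sub>3)\<close> and \<open>(B - \<lambda>\<^sub>2)(B - \<lambda>\<^sub>3)\<close>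
  have rank at most one, with images in the lines through the cyclic vectors \<open>e\<^sub>1\<close> and \<open>e\<^sub>3\<close>; call
  the corresponding linear forms \<open>r\<close> and \<open>s\<close>. Hence a proper invariant subspace is annihilated by
  \<open>r\<close>, by \<open>r B\<close> and by \<open>s\<close>. The determinant of these three forms is a nonzero multiple of
  \<open>(\<lambda>\<^sub>2\<^sup>2 + \<lambda>\<^sub>1\<lambda>\<^sub>3) (\<lambda>\<^sub>1\<^sup>2 + \<lambda>\<^sub>2\<lambda>\<^sub>3)\<^sup>2 (\<lambda>\<^sub>3\<^sup>2 + \<lambda>\<^sub>1\<lambda>\<^sub>2)\<close>, so the subspace is zero.\<close>

lemma mat3_mult_vector:
  fixes a b c d e f g h i x y z :: "'a::semiring_1"
  shows "mat3 a b c d e f g h i *v vector [x, y, z] =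
    vector [a * x + b * y + c * z, d * x + e * y + f * z, g * x + h * y + i * z]"
  by (simp add: mat3_def vec_eq_iff forall_3 matrix_vector_mult_def sum_3)

lemma scale_vector_3:
  fixes k x y z :: "'a::semiring_1"
  shows "k *s vector [x, y, z] = (vector [k * x, k * y, k * z] :: 'a ^ 3)"
  by (simp add: vec_eq_iff forall_3)

lemma add_vector_3:
  fixes x y z x' y' z' :: "'a::semiring_1"
  shows "vector [x, y, z] + vector [x', y', z'] = (vector [x + x', y + y', z + z'] :: 'a ^ 3)"
  by (simp add: vec_eq_iff forall_3)

lemma vector_3_cases:
  fixes v :: "'a::zero ^ 3"
  obtains x y z where "v = vector [x, y, z]"
proof
  show "v = vector [v $ 1, v $ 2, v $ 3]"
    by (simp add: vec_eq_iff forall_3)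
qed

lemma subspace_basis_UNIV:
  fixes V :: "('a::field ^ 3) set"
  assumes V: "vec.subspace V"
    and basis: "vector [1, 0, 0] \<in> V" "vector [0, 1, 0] \<in> V" "vector [0, 0, 1] \<in> V"
  shows "V = UNIV"
proof -
  have "v \<in> V" for v
  proof (cases v rule: vector_3_cases)
    case (1 x y z)
    have "x *s vector [1, 0, 0] + y *s vector [0, 1, 0] + z *s vector [0, 0, 1] \<in> V"
      by (intro vec.subspace_add vec.subspace_scale V basis)
    then show ?thesis
      by (simp add: 1 scale_vector_3 add_vector_3)
  qed
  then show ?thesis by auto
qed

lemma subspace_scale_cancel:
  fixes V :: "('a::field ^ 'n) set"
  assumes "vec.subspace V" "k *s v \<in> V" "k \<noteq> 0"
  shows "v \<in> V"
  using vec.subspace_scale[OF assms(1,2), of "inverse k"] assms(3) by simp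

text \<open>The letter \<open>d\<close> stands for the entry \<open>a c / b + b\<close>.\<close>

lemma triangular_braid_pair_invariant_subspace:
  fixes V :: "('a::field ^ 3) set" and a b c d :: 'a
  assumes V: "vec.subspace V"
    and A: "\<And>v. v \<in> V \<Longrightarrow> mat3 a d b 0 b b 0 0 c *v v \<in> V"
    and B: "\<And>v. v \<in> V \<Longrightarrow> mat3 c 0 0 (- b) b 0 b (- d) a *v v \<in> V"
    and nz: "a \<noteq> 0" "b \<noteq> 0" "c \<noteq> 0"
    and d: "b * d = a * c + b\<^sup>2"
    and nd: "(a\<^sup>2 + b * c) * (b\<^sup>2 + a * c) * (c\<^sup>2 + a * b) \<noteq> 0"
  shows "V = {0} \<or> V = UNIV"
proof -
  note vec_simps = mat3_mult_vector scale_vector_3 add_vector_3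
  have A': "vector [a * x + d * y + b * z, b * y + b * z, c * z] \<in> V"
    if "vector [x, y, z] \<in> V" for x y z
    using A[OF that] by (simp add: vec_simps)
  have B': "vector [c * x, b * y - b * x, b * x - d * y + a * z] \<in> V"
    if "vector [x, y, z] \<in> V" for x y z
    using B[OF that] by (simp add: vec_simps)
  have comb: "vector [k * x + l * x', k * y + l * y', k * z + l * z'] \<in> V"
    if "vector [x, y, z] \<in> V" "vector [x', y', z'] \<in> V" for k l x y z x' y' z'
    using vec.subspace_add[OF V vec.subspace_scale[OF V that(1), of k]
        vec.subspace_scale[OF V that(2), of l]]
    by (simp add: vec_simps)
  have cancel: "vector [x, y, z] \<in> V" if "vector [k * x, k * y, k * z] \<in> V" "k \<noteq> 0" for k x y z
    using subspace_scale_cancel[OF V _ that(2), of "vector [x, y, z]"] that(1)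
    by (simp add: vec_simps)
  \<comment> \<open>Subtracting \<open>c\<close> times the first basis vector from its image under
    \<open>B\<close> leaves a multiple of \<open>w\<close>. The image of \<open>w\<close> under
    \<open>A\<close> is \<open>c\<close> times the third basis vector, modulo the first.\<close>
  have e1_cyclic: "V = UNIV" if e1: "vector [1, 0, 0] \<in> V"
  proof -
    have "vector [0, - b, b] \<in> V"
      using comb[OF B'[OF e1] e1, of 1 "- c"] by simp
    then have w: "vector [0, - 1, 1] \<in> V"
      using cancel[of b 0 "- 1" 1] nz by simp
    have "vector [0, 0, c] \<in> V"
      using comb[OF A'[OF w] e1, of 1 "d - b"] by simp
    then have e3: "vector [0, 0, 1] \<in> V"
      using cancel[of c 0 0 1] nz by simp
    have e2: "vector [0, 1, 0] \<in> V"
      using comb[OF w e3, of "- 1" 1] by simp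
    show ?thesis using subspace_basis_UNIV[OF V e1 e2 e3] .
  qed
  have e3_cyclic: "V = UNIV" if e3: "vector [0, 0, 1] \<in> V"
  proof -
    have "vector [b, b, 0] \<in> V"
      using comb[OF A'[OF e3] e3, of 1 "- c"] by simp
    then have w: "vector [1, 1, 0] \<in> V"
      using cancel[of b 1 1 0] nz by simp
    have "vector [c, 0, 0] \<in> V"
      using comb[OF B'[OF w] e3, of 1 "d - b"] by simp
    then have "vector [1, 0, 0] \<in> V"
      using cancel[of c 1 0 0] nz by simp
    then show ?thesis by (rule e1_cyclic)
  qed
  \<comment> \<open>The first row of \<open>(A - b)(A - c)\<close>, simplified by
    \<open>b * d = a * c + b\<^sup>2\<close>; the other two rows vanish.\<close>
  define r where
    "r x y z = (a - b) * (a - c) * x + d * (a - c) * y + a * (b + c) * z" for x y z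
  have r_image: "vector [r x y z, 0, 0] \<in> V" if v: "vector [x, y, z] \<in> V" for x y z
  proof -
    \<comment> \<open>The right-hand side is \<open>A\<^sup>2 v - (b + c) A v + b c v\<close>, left
      unsimplified so that it matches the nested instances of \<open>comb\<close> literally.\<close>
    have "vector [r x y z, 0, 0] =
      (vector [1 * (1 * (a * (a * x + d * y + b * z) + d * (b * y + b * z) + b * (c * z))
          + - (b + c) * (a * x + d * y + b * z)) + b * c * x,
        1 * (1 * (b * (b * y + b * z) + b * (c * z)) + - (b + c) * (b * y + b * z)) + b * c * y,
        1 * (1 * (c * (c * z)) + - (b + c) * (c * z)) + b * c * z] :: 'a ^ 3)"
      using d by (simp add: vec_eq_iff forall_3 r_def) algebra
    then show ?thesis
      using comb[OF comb[OF A'[OF A'[OF v]] A'[OF v], of 1 "- (b + c)"] v, of 1 "b * c"]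
      by (simp only:)
  qed
  \<comment> \<open>The involution sending \<open>(x, y, z)\<close> to \<open>(z, - y, x)\<close>
    conjugates \<open>A\<close> into \<open>B\<close>, so the form for \<open>B\<close> is
    \<open>r\<close> composed with it.\<close>
  have s_image: "vector [0, 0, r z (- y) x] \<in> V" if v: "vector [x, y, z] \<in> V" for x y z
  proof -
    let ?y = "b * y - b * x" and ?z = "b * x - d * y + a * z"
    have "vector [0, 0, r z (- y) x] =
      (vector [1 * (1 * (c * (c * x)) + - (b + c) * (c * x)) + b * c * x,
        1 * (1 * (b * ?y - b * (c * x)) + - (b + c) * ?y) + b * c * y,
        1 * (1 * (b * (c * x) - d * ?y + a * ?z) + - (b + c) * ?z) + b * c * z] :: 'a ^ 3)"
      using d by (simp add: vec_eq_iff forall_3 r_def) algebra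
    then show ?thesis
      using comb[OF comb[OF B'[OF B'[OF v]] B'[OF v], of 1 "- (b + c)"] v, of 1 "b * c"]
      by (simp only:)
  qed
  show ?thesis
  proof (cases "V = UNIV")
    case False
    have r0: "r x y z = 0" if "vector [x, y, z] \<in> V" for x y z
      using cancel[of "r x y z" 1 0 0] r_image[OF that] e1_cyclic False by auto
    have s0: "r z (- y) x = 0" if "vector [x, y, z] \<in> V" for x y z
      using cancel[of "r z (- y) x" 0 0 1] s_image[OF that] e3_cyclic False by auto
    have "v = 0" if "v \<in> V" for v
    proof (cases v rule: vector_3_cases)
      case (1 x y z)
      with that have v: "vector [x, y, z] \<in> V" by simp
      note eqs = r0[OF v] s0[OF v] r0[OF B'[OF v]]
      \<comment> \<open>Up to sign, this is the determinant of the three linear forms in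
        \<open>eqs\<close>, reduced by the relation for \<open>d\<close>; the conclusion is Cramer's
        rule.\<close>
      let ?\<Delta> = "d * (a\<^sup>2 + b * c)\<^sup>2 * (c\<^sup>2 + a * b)"
      have "b * d \<noteq> 0" using nd by (simp add: d add.commute)
      then have nz_det: "?\<Delta> \<noteq> 0" using nd by simp
      have "?\<Delta> * x = 0" "?\<Delta> * y = 0" "?\<Delta> * z = 0"
        using eqs d unfolding r_def by algebra+
      then have "x = 0" "y = 0" "z = 0" using nz_det by simp_all
      then show ?thesis by (simp add: 1 vec_eq_iff forall_3)
    qed
    then show ?thesis using vec.subspace_0[OF V] by auto
  qed simp
qed

theorem corollary22:
  fixes \<rho> :: "sb3_gen gword set \<Rightarrow> complex ^ 3 ^ 3"
    and l1 l2 l3 a1 b1 c1 e1 f1 i1 a2 d2 e2 g2 h2 i2 :: complex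
  assumes rep: "\<rho> \<in> hom SB3 GL"
    and sigma1: "\<rho> (SB3_gen Sigma1) =
      mat3 l1 (l1 * inverse l2 * l3 + l2) l2
           0  l2                          l2
           0  0                           l3"
    and sigma2: "\<rho> (SB3_gen Sigma2) =
      mat3 l3     0                              0
           (- l2) l2                             0
           l2     (- (l1 * inverse l2 * l3) - l2) l1"
    and tau1: "\<rho> (SB3_gen Tau1) =
      mat3 a1 b1 c1
           0  e1 f1
           0  0  i1"
    and tau2: "\<rho> (SB3_gen Tau2) =
      mat3 a2 0  0
           d2 e2 0
           g2 h2 i2"
    and nonzero_lambda: "l1 \<noteq> 0" "l2 \<noteq> 0" "l3 \<noteq> 0"
    and nonzero_diag: "a1 \<noteq> 0" "e1 \<noteq> 0" "i1 \<noteq> 0" "a2 \<noteq> 0" "e2 \<noteq> 0" "i2 \<noteq> 0"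
    and nondegenerate: "(l1\<^sup>2 + l2 * l3) * (l2\<^sup>2 + l1 * l3) * (l3\<^sup>2 + l1 * l2) \<noteq> 0"
    and "l2 \<noteq> - l3"
    and a1_i2: "a1 = i2"
      "i2 = (c1 * l2 * (l1 - l2) * (l1 - l3) + e1 * l1 * l2 * (l2 + l3)
               + f1 * l3 * (l1 - l2) * (l1 + l2)) / (l1 * l2 * (l2 + l3))"
    and b1_h2: "b1 = - h2"
      "- h2 = ((l1 * l3 + l2\<^sup>2) * (c1 * l2 * (l1 - l3) + f1 * l3 * (l1 + l2)))
               / (l1 * l2\<^sup>2 * (l2 + l3))"
    and i1_a2: "i1 = a2" "a2 = e1 + f1 * (l3 / l2 - 1)"
    and "d2 = - f1" and "e2 = e1" and "g2 = c1"
  shows "irreducible_rep SB3 \<rho>"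
proof -
  have inv: "\<rho> (SB3_gen x) *v v \<in> V"
    if "\<forall>g\<in>carrier SB3. \<forall>v\<in>V. \<rho> g *v v \<in> V" "v \<in> V" for V x v
    using that pres_gen_carrier[of SB3_relations x] by (simp add: SB3_def SB3_gen_def)
  \<comment> \<open>Naming the entry and clearing its denominator gives the relation required of
    \<open>d\<close>, with \<open>l1\<close>, \<open>l2\<close>, \<open>l3\<close> as
    \<open>a\<close>, \<open>b\<close>, \<open>c\<close>.\<close>
  define D where "D = l1 * inverse l2 * l3 + l2"
  have D: "l2 * D = l1 * l3 + l2\<^sup>2"
    using nonzero_lambda by (simp add: D_def field_simps power2_eq_square)
  have minus_D: "- (l1 * inverse l2 * l3) - l2 = - D"
    by (simp add: D_def)
  show ?thesis
    unfolding irreducible_rep_def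
  proof (intro allI impI, elim conjE)
    fix V :: "(complex ^ 3) set"
    assume "vec.subspace V" and V: "\<forall>g\<in>carrier SB3. \<forall>v\<in>V. \<rho> g *v v \<in> V"
    then show "V = {0} \<or> V = UNIV"
      using triangular_braid_pair_invariant_subspace[OF _ _ _ nonzero_lambda D] nondegenerate
        inv[OF V, of _ Sigma1] inv[OF V, of _ Sigma2]
      by (simp add: sigma1 sigma2 minus_D flip: D_def)
  qed
qed

end
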